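(* A poset is a chainmail if and only if every connected set in it has a join.
   Context: In a poset $P$, a mail is a non-empty subset of $P$ having a common lower bound in $P$. A subset $M$ of $P$ is mail-connected if $M\neq\varnothing$ and for any $x,y\in M$ there is a sequence $s_1,\dots,s_n\in M$ with $s_1=x$, $s_n=y$ and each $\{s_i,s_{i+1}\}$ ($1\le i\le n-1$) a mail in $P$. A chainmail is a poset in which every mail-connected subset has a join. A subset $C$ of $P$ is a connected set in $P$ if $C\neq\varnothing$ and for any $x,y\in C$ there is a sequence $s_1,\dots,s_n\in C$ with $s_1=x$, $s_n=y$ and, for each $1\le i\le n-1$, $s_i\leqslant s_{i+1}$ or $s_{i+1}\leqslant s_i$. *)

theory Defs
  imports "HOL-Algebra.Order"
begin

text \<open>
  A poset is a structure \<open>P\<close> with \<^term>\<open>partial_order P\<close>; its carrier may be empty.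
\<close>

definition mail :: "('a, 'b) gorder_scheme \<Rightarrow> 'a set \<Rightarrow> bool" where
  "mail P M \<longleftrightarrow> M \<subseteq> carrier P \<and> M \<noteq> {} \<and> Lower P M \<noteq> {}"

text \<open>The list \<open>s\<close> is the sequence $s_1,\dots,s_n$; non-emptiness expresses $n \ge 1$.\<close>

definition linked_by :: "('a \<Rightarrow> 'a \<Rightarrow> bool) \<Rightarrow> 'a set \<Rightarrow> 'a \<Rightarrow> 'a \<Rightarrow> bool" where
  "linked_by R M x y \<longleftrightarrow>
    (\<exists>s. s \<noteq> [] \<and> set s \<subseteq> M \<and> hd s = x \<and> last s = y \<and>
         (\<forall>i. Suc i < length s \<longrightarrow> R (s ! i) (s ! Suc i)))"

definition mail_connected :: "('a, 'b) gorder_scheme \<Rightarrow> 'a set \<Rightarrow> bool" where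
  "mail_connected P M \<longleftrightarrow> M \<subseteq> carrier P \<and> M \<noteq> {} \<and>
    (\<forall>x\<in>M. \<forall>y\<in>M. linked_by (\<lambda>u v. mail P {u, v}) M x y)"

definition connected_in :: "('a, 'b) gorder_scheme \<Rightarrow> 'a set \<Rightarrow> bool" where
  "connected_in P C \<longleftrightarrow> C \<subseteq> carrier P \<and> C \<noteq> {} \<and>
    (\<forall>x\<in>C. \<forall>y\<in>C. linked_by (\<lambda>u v. u \<sqsubseteq>\<^bsub>P\<^esub> v \<or> v \<sqsubseteq>\<^bsub>P\<^esub> u) C x y)"

definition has_join :: "('a, 'b) gorder_scheme \<Rightarrow> 'a set \<Rightarrow> bool" where
  "has_join P A \<longleftrightarrow> (\<exists>j. least P j (Upper P A))"

definition chainmail :: "('a, 'b) gorder_scheme \<Rightarrow> bool" where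
  "chainmail P \<longleftrightarrow> partial_order P \<and> (\<forall>M. mail_connected P M \<longrightarrow> has_join P M)"

end

theory Submission
  imports Defs
begin

text \<open>
  Comparable elements form a mail, so connected sets are mail-connected. Conversely, the
  down-closure of a mail-connected set \<open>M\<close> has the same upper bounds as \<open>M\<close>, and it is connected
  because it contains a common lower bound of each mail contained in \<open>M\<close>.
\<close>

text \<open>Trades indexed lists for a reflexive transitive closure, so that paths can be
  concatenated and handled by induction. The conjunct \<open>x \<in> M\<close> excludes the empty
  path at a point outside \<open>M\<close>: the closure is reflexive everywhere, whereas a list with
  entries in \<open>M\<close> cannot start there.\<close>

lemma linked_by_iff_rtranclp:
  "linked_by R M x y \<longleftrightarrow> x \<in> M \<and> (\<lambda>u v. u \<in> M \<and> v \<in> M \<and> R u v)\<^sup>*\<^sup>* x y"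
  (is "_ \<longleftrightarrow> _ \<and> ?R\<^sup>*\<^sup>* x y")
proof
  assume "linked_by R M x y"
  then obtain s where s: "s \<noteq> []" "set s \<subseteq> M" "hd s = x" "last s = y" "successively R s"
    by (auto simp: linked_by_def successively_conv_nth)
  have "?R\<^sup>*\<^sup>* (hd s) (last s)"
    using s(1,2,5)
  proof (induction s rule: induct_list012)
    case (3 a b t)
    then have "?R a b" and "?R\<^sup>*\<^sup>* b (last (b # t))" by auto
    then have "?R\<^sup>*\<^sup>* a (last (b # t))" by (rule converse_rtranclp_into_rtranclp)
    then show ?case by simp
  qed auto
  then show "x \<in> M \<and> ?R\<^sup>*\<^sup>* x y"
    using s hd_in_set[of s] by auto
next
  assume "x \<in> M \<and> ?R\<^sup>*\<^sup>* x y"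
  then have "x \<in> M" "?R\<^sup>*\<^sup>* x y" by auto
  from this(2) have
    "\<exists>s. s \<noteq> [] \<and> set s \<subseteq> M \<and> hd s = x \<and> last s = y \<and> successively R s"
  proof induction
    case base
    show ?case using \<open>x \<in> M\<close> by (intro exI[of _ "[x]"]) simp
  next
    case (step y z)
    then obtain s where
      "s \<noteq> []" "set s \<subseteq> M" "hd s = x" "last s = y" "successively R s" by blast
    with step.hyps show ?case
      by (intro exI[of _ "s @ [z]"]) (auto simp: successively_append_iff)
  qed
  then show "linked_by R M x y"
    by (auto simp: linked_by_def successively_conv_nth)
qed

lemma linked_by_refl: "x \<in> M \<Longrightarrow> linked_by R M x x"
  by (simp add: linked_by_iff_rtranclp)

lemma linked_by_single: "\<lbrakk>x \<in> M; y \<in> M; R x y\<rbrakk> \<Longrightarrow> linked_by R M x y"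
  by (simp add: linked_by_iff_rtranclp r_into_rtranclp)

lemma linked_by_trans: "\<lbrakk>linked_by R M x y; linked_by R M y z\<rbrakk> \<Longrightarrow> linked_by R M x z"
  by (auto simp: linked_by_iff_rtranclp)

text \<open>Replace each link of a path by a path for the new relation and concatenate. Both
  directions of the theorem change the relation in this way; one of them also enlarges the
  set.\<close>

lemma linked_by_lift:
  assumes "linked_by R M x y" and "M \<subseteq> N"
    and step: "\<And>u v. \<lbrakk>u \<in> M; v \<in> M; R u v\<rbrakk> \<Longrightarrow> linked_by S N u v"
  shows "linked_by S N x y"
proof -
  from assms(1) have "x \<in> M" "(\<lambda>u v. u \<in> M \<and> v \<in> M \<and> R u v)\<^sup>*\<^sup>* x y"
    by (auto simp: linked_by_iff_rtranclp)
  from this(2) show ?thesis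
  proof induction
    case base
    show ?case using \<open>x \<in> M\<close> \<open>M \<subseteq> N\<close> by (auto intro: linked_by_refl)
  next
    case (step y z)
    then have "linked_by S N y z" by (intro assms(3)) auto
    with step.IH show ?case by (rule linked_by_trans)
  qed
qed

definition down_closure :: "('a, 'b) gorder_scheme \<Rightarrow> 'a set \<Rightarrow> 'a set" where
  "down_closure P M = {x \<in> carrier P. \<exists>m\<in>M. x \<sqsubseteq>\<^bsub>P\<^esub> m}"

context partial_order
begin

lemma subset_down_closure: "M \<subseteq> carrier L \<Longrightarrow> M \<subseteq> down_closure L M"
  unfolding down_closure_def using le_refl by blast

text \<open>By transitivity, an upper bound of \<open>M\<close> also bounds everything below an
  element of \<open>M\<close>. The other inclusion holds because \<open>Upper\<close> is
  antitone.\<close>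

lemma Upper_down_closure:
  assumes "M \<subseteq> carrier L"
  shows "Upper L (down_closure L M) = Upper L M"
proof
  show "Upper L (down_closure L M) \<subseteq> Upper L M"
    using subset_down_closure[OF assms] by (rule Upper_antimono)
  show "Upper L M \<subseteq> Upper L (down_closure L M)"
  proof
    fix u assume u: "u \<in> Upper L M"
    have "x \<sqsubseteq> u" if x: "x \<in> carrier L" "m \<in> M" "x \<sqsubseteq> m" for x m
    proof (rule le_trans[OF x(3)])
      show "m \<sqsubseteq> u" using u x(2) assms by (auto simp: Upper_def)
    qed (use u x assms in \<open>auto simp: Upper_def\<close>)
    then show "u \<in> Upper L (down_closure L M)"
      using u by (auto simp: Upper_def down_closure_def)
  qed
qed

text \<open>The smaller of the two elements is itself a common lower bound.\<close>

lemma mail_if_comparable: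
  assumes "u \<in> carrier L" "v \<in> carrier L" "u \<sqsubseteq> v \<or> v \<sqsubseteq> u"
  shows "mail L {u, v}"
proof -
  have "u \<in> Lower L {u, v} \<or> v \<in> Lower L {u, v}"
    using assms by (auto simp: Lower_def)
  then show ?thesis using assms by (auto simp: mail_def)
qed

lemma mail_connected_if_connected_in:
  assumes "connected_in L C"
  shows "mail_connected L C"
proof -
  have C: "C \<subseteq> carrier L" using assms by (simp add: connected_in_def)
  have "linked_by (\<lambda>u v. mail L {u, v}) C x y" if "x \<in> C" "y \<in> C" for x y
  \<comment> \<open>The set stays the same: every order link is already a single mail link.\<close>
  proof (rule linked_by_lift[OF _ subset_refl])
    show "linked_by (\<lambda>u v. u \<sqsubseteq> v \<or> v \<sqsubseteq> u) C x y"
      using assms that by (simp add: connected_in_def)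
    show "linked_by (\<lambda>u v. mail L {u, v}) C u v"
      if "u \<in> C" "v \<in> C" "u \<sqsubseteq> v \<or> v \<sqsubseteq> u" for u v
      using that C by (intro linked_by_single mail_if_comparable) auto
  qed
  then show ?thesis
    using assms by (simp add: connected_in_def mail_connected_def)
qed

text \<open>From \<open>x\<close> go up to some \<open>m\<close> in \<open>M\<close>, follow a mail
  path inside \<open>M\<close> to some \<open>n\<close> above \<open>y\<close>, and go down to
  \<open>y\<close>. Each mail link from \<open>u\<close> to \<open>v\<close> on the way becomes a
  descent to a common lower bound followed by an ascent.\<close>

lemma connected_in_down_closure:
  assumes "mail_connected L M"
  shows "connected_in L (down_closure L M)"
proof -
  let ?D = "down_closure L M"
  let ?link = "linked_by (\<lambda>u v. u \<sqsubseteq> v \<or> v \<sqsubseteq> u) ?D"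
  have M: "M \<subseteq> carrier L" "M \<noteq> {}" using assms by (auto simp: mail_connected_def)
  note MD = subset_down_closure[OF M(1)]
  have mail_link: "?link u v" if uv: "u \<in> M" "v \<in> M" "mail L {u, v}" for u v
  proof -
    obtain w where "w \<in> Lower L {u, v}"
      using uv(3) unfolding mail_def by blast
    moreover have "u \<in> carrier L" "v \<in> carrier L" using uv(1,2) M(1) by auto
    ultimately have w: "w \<in> carrier L" "w \<sqsubseteq> u" "w \<sqsubseteq> v"
      by (simp_all add: Lower_def)
    \<comment> \<open>The lower bound \<open>w\<close> may lie outside \<open>M\<close>, but it lies
      below \<open>u\<close>; this is why \<open>M\<close> is enlarged to its down-closure.\<close>
    then have "w \<in> ?D" using uv by (auto simp: down_closure_def)
    then have "?link u w" "?link w v"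
      using w uv MD by (auto intro: linked_by_single)
    then show ?thesis by (rule linked_by_trans)
  qed
  have "?link x y" if xy: "x \<in> ?D" "y \<in> ?D" for x y
  proof -
    obtain m n where mn: "m \<in> M" "x \<sqsubseteq> m" "n \<in> M" "y \<sqsubseteq> n"
      using xy by (auto simp: down_closure_def)
    then have "linked_by (\<lambda>u v. mail L {u, v}) M m n"
      using assms by (auto simp: mail_connected_def)
    then have "?link m n" using MD mail_link by (rule linked_by_lift)
    moreover have xm: "?link x m" and ny: "?link n y"
      using mn xy MD by (auto intro: linked_by_single)
    \<comment> \<open>The premise left open in the composed rule is the middle piece, the path from
      \<open>m\<close> to \<open>n\<close>.\<close>
    ultimately show ?thesis using linked_by_trans[OF linked_by_trans[OF xm] ny] by simp
  qed
  then show ?thesis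
    using M(2) MD unfolding connected_in_def by (auto simp: down_closure_def)
qed

end

theorem theorem4:
  fixes P :: "('a, 'b) gorder_scheme"
  assumes "partial_order P"
  shows "chainmail P \<longleftrightarrow> (\<forall>C. connected_in P C \<longrightarrow> has_join P C)"
proof -
  interpret partial_order P by fact
  have "has_join P M"
    if "\<forall>C. connected_in P C \<longrightarrow> has_join P C" "mail_connected P M" for M
  proof -
    have "has_join P (down_closure P M)"
      using that connected_in_down_closure by blast
    moreover have "M \<subseteq> carrier P" using that(2) by (simp add: mail_connected_def)
    \<comment> \<open>A join of a set is determined by the upper bounds alone, so the join of the
      down-closure is a join of \<open>M\<close>.\<close>
    ultimately show ?thesis by (simp add: has_join_def Upper_down_closure)
  qed
  then show ?thesis
    using assms mail_connected_if_connected_in by (auto simp: chainmail_def)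
qed

end
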